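(* Fix an integer $d\ge 1$ and let $N,M,L\ge 1$ be integers with $N\ge ML$. Let $P\subset[N]^d\times[M]\subset\mathbb{Z}^{d+1}$ be a set of lattice points. Assume that for each $p\in P$ we are given an integer direction vector $s_p=(u_p,1)\in\mathbb{Z}^{d+1}$ with $\|u_p\|_\infty\le L$, such that for all distinct $p,p'\in P$ one has $p'\notin p+\mathbb{R}s_p$ (equivalently, since the last coordinate of $s_p$ is $1$, $p'\notin p+\mathbb{Z}s_p$). Then there exist points $p_1,\dots,p_{|P|}\in[0,1]^{d+1}$ and lines $\ell_1,\dots,\ell_{|P|}$ in $\mathbb{R}^{d+1}$ with $p_i\in\ell_i$ such that for each $i\ne j$, $$d_\infty(p_i,\ell_j)\ \ge\ \frac{1}{2N}.$$
   Context: $[n]=\{1,2,\dots,n\}$. For a point $p$ and a line $\ell$ in $\mathbb{R}^{d+1}$, $d_\infty(p,\ell)=\min_{q\in\ell}\|p-q\|_\infty$, where $\|\cdot\|_\infty$ is the sup norm. *)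

theory Defs
  imports "HOL-Analysis.Analysis"
begin

text \<open>
  Throughout, \<open>d\<close> is the cardinality of the index type \<open>'d\<close>. The spaces \<open>\<int>\<^bsup>d+1\<^esup>\<close> and
  \<open>\<real>\<^bsup>d+1\<^esup>\<close> are the products \<open>(int ^ 'd) \<times> int\<close> and \<open>(real ^ 'd) \<times> real\<close>, the second factor
  being the last coordinate. On the latter, \<open>infnorm\<close> is the maximum of the absolute values of
  all \<open>d + 1\<close> coordinates and \<open>cbox 0 One\<close> is the unit cube.
\<close>

definition real_vec :: "int ^ 'd \<Rightarrow> real ^ 'd" where
  "real_vec x = (\<chi> i. real_of_int (x $ i))"

definition real_point :: "(int ^ 'd) \<times> int \<Rightarrow> (real ^ 'd) \<times> real" where
  "real_point p = (real_vec (fst p), real_of_int (snd p))"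

definition lattice_box :: "nat \<Rightarrow> nat \<Rightarrow> ((int ^ 'd) \<times> int) set" where
  "lattice_box N M = {x. \<forall>i. x $ i \<in> {1..int N}} \<times> {1..int M}"

definition line_dir :: "'a::real_vector \<Rightarrow> 'a \<Rightarrow> 'a set" where
  "line_dir p v = {p + t *\<^sub>R v | t. True}"

definition is_line :: "'a::real_vector set \<Rightarrow> bool" where
  "is_line l \<longleftrightarrow> (\<exists>p v. v \<noteq> 0 \<and> l = line_dir p v)"

definition dist_inf :: "'a::euclidean_space \<Rightarrow> 'a set \<Rightarrow> real" where
  "dist_inf p l = (INF q\<in>l. infnorm (p - q))"

text \<open>On lines the infimum is attained, so it is a minimum.\<close>

lemma dist_inf_attained:
  fixes l :: "'a::euclidean_space set"
  assumes "is_line l"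
  shows "\<exists>q\<in>l. dist_inf p l = infnorm (p - q) \<and> (\<forall>r\<in>l. infnorm (p - q) \<le> infnorm (p - r))"
proof -
  obtain a v where v: "v \<noteq> 0" and l: "l = range (\<lambda>t. a + t *\<^sub>R v)"
    using assms by (auto simp: is_line_def line_dir_def)
  define f where "f = (\<lambda>t::real. infnorm (p - (a + t *\<^sub>R v)))"
  have pos: "infnorm v > 0"
    using v by (simp add: infnorm_pos_lt)
  have cont: "continuous_on S f" for S
    unfolding f_def by (intro continuous_intros)
  define B where "B = 2 * infnorm (p - a) / infnorm v"
  have "B \<ge> 0"
    using pos by (simp add: B_def infnorm_pos_le)
  then obtain t where "\<forall>s\<in>{-B..B}. f t \<le> f s"
    using continuous_attains_inf[of "{-B..B}" f] cont by auto
  moreover have "f 0 \<le> f s" if "s \<notin> {-B..B}" for s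
  proof -
    have "B \<le> \<bar>s\<bar>"
      using that by auto
    then have "2 * infnorm (p - a) \<le> infnorm (s *\<^sub>R v)"
      using pos by (simp add: B_def infnorm_mul field_simps)
    moreover have "infnorm (s *\<^sub>R v) \<le> infnorm (p - a) + f s"
      using infnorm_triangle[of "p - a" "- (p - (a + s *\<^sub>R v))"]
      by (simp add: f_def infnorm_neg[of "p - (a + s *\<^sub>R v)"] del: minus_diff_eq)
    ultimately show ?thesis
      by (simp add: f_def)
  qed
  ultimately have min: "f t \<le> f s" for s
    using \<open>B \<ge> 0\<close> by (meson atLeastAtMost_iff neg_le_0_iff_le order_trans)
  then have "(INF s. f s) = f t"
    by (intro cInf_eq_minimum) auto
  then have "dist_inf p l = f t"
    by (simp add: dist_inf_def l f_def image_image)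
  with min show ?thesis
    by (auto simp: l f_def)
qed

end

theory Submission
  imports Defs
begin

text \<open>
  Rescale by \<open>(x, y) \<mapsto> (x / N, y / M)\<close>, and carry the line through \<open>p\<close> in direction \<open>s\<^sub>p\<close>
  along. A point of the line \<open>p + \<real>s\<^sub>p\<close> at height \<open>y' - e\<close>, where \<open>y'\<close> is the height of \<open>p'\<close>, is
  at vertical distance \<open>\<bar>e\<bar> / M\<close> from \<open>p'\<close> after rescaling. If this is less than \<open>1 / (2N)\<close>, then
  \<open>\<bar>e\<bar> L < M L / (2N) \<le> 1/2\<close>; at height \<open>y'\<close> itself the line passes through a lattice point other
  than \<open>p'\<close>, so some horizontal coordinate still differs by at least \<open>1 - 1/2\<close> before rescaling.
\<close>

lemma abs_component_le_infnorm:
  fixes v :: "real ^ 'd"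
  shows "\<bar>v $ i\<bar> \<le> infnorm v"
  using Basis_le_infnorm[of "axis i 1" v] by (simp add: axis_in_Basis_iff inner_axis)

lemma abs_fst_component_le_infnorm:
  fixes z :: "(real ^ 'd) \<times> real"
  shows "\<bar>fst z $ i\<bar> \<le> infnorm z"
proof -
  have "(axis i 1, 0) \<in> (Basis :: ((real ^ 'd) \<times> real) set)"
    by (simp add: Basis_prod_def axis_in_Basis_iff)
  then have "\<bar>z \<bullet> (axis i 1, 0)\<bar> \<le> infnorm z"
    by (rule Basis_le_infnorm)
  then show ?thesis
    by (cases z) (simp add: inner_axis)
qed

lemma abs_snd_le_infnorm:
  fixes z :: "'a::euclidean_space \<times> real"
  shows "\<bar>snd z\<bar> \<le> infnorm z"
proof -
  have "(0, 1) \<in> (Basis :: ('a \<times> real) set)"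
    by (simp add: Basis_prod_def)
  then have "\<bar>z \<bullet> (0, 1)\<bar> \<le> infnorm z"
    by (rule Basis_le_infnorm)
  then show ?thesis
    by (cases z) simp
qed

lemma mem_unit_cube_prod:
  fixes v :: "real ^ 'd" and w :: real
  assumes "\<And>i. 0 \<le> v $ i \<and> v $ i \<le> 1" and "0 \<le> w" and "w \<le> 1"
  shows "(v, w) \<in> cbox 0 One"
  unfolding mem_box
proof
  fix b :: "(real ^ 'd) \<times> real"
  assume b: "b \<in> Basis"
  then consider i where "b = (axis i 1, 0)" | "b = (0, 1)"
    by (auto simp: Basis_prod_def Basis_vec_def)
  then have "0 \<le> (v, w) \<bullet> b \<and> (v, w) \<bullet> b \<le> 1"
    using assms by cases (auto simp: inner_axis)
  then show "0 \<bullet> b \<le> (v, w) \<bullet> b \<and> (v, w) \<bullet> b \<le> One \<bullet> b"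
    using b by simp
qed

text \<open>This map is linear, so it serves for directions as well as for points: the image of
  \<open>line_dir p v\<close> is \<open>line_dir (rescale N M p) (rescale N M v)\<close>.\<close>

definition rescale :: "nat \<Rightarrow> nat \<Rightarrow> (real ^ 'd) \<times> real \<Rightarrow> (real ^ 'd) \<times> real" where
  "rescale N M z = (fst z /\<^sub>R real N, snd z / real M)"

lemma rescale_mem_unit_cube:
  assumes "p \<in> lattice_box N M"
  shows "rescale N M (real_point p) \<in> cbox 0 One"
proof -
  have x: "1 \<le> fst p $ i" "fst p $ i \<le> int N" for i
    using assms by (auto simp: lattice_box_def)
  have y: "1 \<le> snd p" "snd p \<le> int M"
    using assms by (auto simp: lattice_box_def)
  \<comment> \<open>Stated for general \<open>k\<close> and \<open>n\<close> so as to cover both the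
    horizontal coordinates, with \<open>n = N\<close>, and the height, with
    \<open>n = M\<close>.\<close>
  have "0 \<le> real_of_int k / real n \<and> real_of_int k / real n \<le> 1"
    if "1 \<le> k" "k \<le> int n" for k n
  proof -
    have "real_of_int k \<le> real n"
      using that(2) by linarith
    then show ?thesis
      using that(1) by (simp add: divide_le_eq_1)
  qed
  from this[OF x] this[OF y] show ?thesis
    unfolding rescale_def
    by (intro mem_unit_cube_prod) (simp_all add: real_point_def real_vec_def divide_inverse_commute)
qed

lemma infnorm_rescale_ge:
  fixes x x' u :: "int ^ 'd" and y y' :: int and N M L :: nat and t :: real
  assumes N: "N \<ge> 1" and M: "M \<ge> 1" and NML: "N \<ge> M * L"
    and u: "infnorm (real_vec u) \<le> real L"
    and off: "real_point (x', y') \<notin> line_dir (real_point (x, y)) (real_point (u, 1))"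
  shows "1 / (2 * real N) \<le> infnorm (rescale N M (real_point (x', y')) -
    (rescale N M (real_point (x, y)) + t *\<^sub>R rescale N M (real_point (u, 1))))"
    (is "_ \<le> infnorm ?z")
proof -
  \<comment> \<open>The direction has last coordinate 1, so the line reaches height
    \<open>y'\<close> at the integer parameter \<open>k\<close>, hence at a lattice point. The point
    of parameter \<open>t\<close> lies \<open>e\<close> below that height, with sign.\<close>
  define k where "k = y' - y"
  define e where "e = of_int k - t"
  have "x' \<noteq> (\<chi> i. x $ i + k * u $ i)"
  proof
    assume "x' = (\<chi> i. x $ i + k * u $ i)"
    then have "real_point (x', y') = real_point (x, y) + of_int k *\<^sub>R real_point (u, 1)"
      by (simp add: real_point_def real_vec_def k_def vec_eq_iff)
    with off show False
      unfolding line_dir_def by blast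
  qed
  then obtain i where "x' $ i \<noteq> x $ i + k * u $ i"
    by (auto simp: vec_eq_iff)
  then have "1 \<le> \<bar>x' $ i - x $ i - k * u $ i\<bar>"
    by linarith
  then have gap: "1 \<le> \<bar>real_of_int (x' $ i) - real_of_int (x $ i) - of_int k * of_int (u $ i)\<bar>"
    by (metis (no_types) of_int_1_le_iff of_int_abs of_int_diff of_int_mult)
  have ui: "\<bar>real_of_int (u $ i)\<bar> \<le> real L"
    using abs_component_le_infnorm[of "real_vec u" i] u by (simp add: real_vec_def)
  have snd_z: "snd ?z = e / real M"
    by (simp add: rescale_def real_point_def e_def k_def diff_divide_distrib add_divide_distrib)
  \<comment> \<open>Since \<open>t = k - e\<close>, the offset is the integer gap at height
    \<open>y'\<close> plus a drift \<open>e * u $ i\<close>.\<close>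
  have fst_z: "fst ?z $ i = (real_of_int (x' $ i) - real_of_int (x $ i) - of_int k * of_int (u $ i)
      + e * of_int (u $ i)) / real N"
    using N by (simp add: rescale_def real_point_def real_vec_def e_def field_simps)
  show ?thesis
  proof (cases "1 / (2 * real N) \<le> \<bar>e\<bar> / real M")
    case True
    then show ?thesis
      using abs_snd_le_infnorm[of ?z] unfolding snd_z by simp
  next
    case False
    \<comment> \<open>The vertical offset is now too small, so the horizontal one must do. As
      \<open>M * L \<le> N\<close>, the drift is at most 1/2 and leaves at least 1/2 of the
      gap.\<close>
    then have "\<bar>e\<bar> * (2 * real N) \<le> real M"
      using N M by (simp add: field_simps)
    then have "\<bar>e\<bar> * (2 * real N) * real L \<le> real M * real L"
      by (simp add: mult_right_mono)
    also have "\<dots> \<le> real N"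
      using NML by (metis of_nat_le_iff of_nat_mult)
    finally have "\<bar>e\<bar> * real L \<le> 1 / 2"
      using N by (simp add: field_simps)
    moreover have "\<bar>e * of_int (u $ i)\<bar> \<le> \<bar>e\<bar> * real L"
      using ui by (simp add: abs_mult mult_left_mono)
    ultimately have "1 / 2 \<le> \<bar>real_of_int (x' $ i) - real_of_int (x $ i)
        - of_int k * of_int (u $ i) + e * of_int (u $ i)\<bar>"
      using gap by linarith
    then have "1 / 2 / real N \<le> \<bar>fst ?z $ i\<bar>"
      unfolding fst_z abs_divide abs_of_nat by (rule divide_right_mono) simp
    also have "\<dots> \<le> infnorm ?z"
      by (rule abs_fst_component_le_infnorm)
    finally show ?thesis
      by simp
  qed
qed

text \<open>A vector is determined by its coordinate function, and only finitely many functions map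
  a finite index type into a finite interval. This makes \<open>card P\<close> the true number of
  points, so that \<open>P\<close> can be enumerated.\<close>

lemma finite_lattice_box: "finite (lattice_box N M :: ((int ^ 'd) \<times> int) set)"
proof -
  have "{x :: int ^ 'd. \<forall>i. x $ i \<in> {1..int N}} \<subseteq> vec_lambda ` (UNIV \<rightarrow>\<^sub>E {1..int N})"
  proof
    fix x :: "int ^ 'd"
    assume "x \<in> {x. \<forall>i. x $ i \<in> {1..int N}}"
    then have "vec_nth x \<in> UNIV \<rightarrow>\<^sub>E {1..int N}"
      by (simp add: PiE_iff)
    then show "x \<in> vec_lambda ` (UNIV \<rightarrow>\<^sub>E {1..int N})"
      by (metis image_eqI vec_nth_inverse)
  qed
  then have "finite {x :: int ^ 'd. \<forall>i. x $ i \<in> {1..int N}}"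
    by (rule finite_subset) (simp add: finite_PiE)
  then show ?thesis
    by (simp add: lattice_box_def)
qed

theorem theorem1p15:
  fixes N M L :: nat
    and P :: "((int ^ 'd) \<times> int) set"
    and u :: "(int ^ 'd) \<times> int \<Rightarrow> int ^ 'd"
    and s :: "(int ^ 'd) \<times> int \<Rightarrow> (int ^ 'd) \<times> int"
  assumes "N \<ge> 1" and "M \<ge> 1" and "L \<ge> 1" and "N \<ge> M * L"
    and "P \<subseteq> lattice_box N M"
    and "\<And>p. p \<in> P \<Longrightarrow> s p = (u p, 1)"
    and "\<And>p. p \<in> P \<Longrightarrow> infnorm (real_vec (u p)) \<le> real L"
    and "\<And>p p'. p \<in> P \<Longrightarrow> p' \<in> P \<Longrightarrow> p \<noteq> p' \<Longrightarrow>
           real_point p' \<notin> line_dir (real_point p) (real_point (s p))"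
  shows "\<exists>(q :: nat \<Rightarrow> (real ^ 'd) \<times> real) (l :: nat \<Rightarrow> ((real ^ 'd) \<times> real) set).
           (\<forall>i\<in>{1..card P}. q i \<in> cbox 0 One \<and> is_line (l i) \<and> q i \<in> l i) \<and>
           (\<forall>i\<in>{1..card P}. \<forall>j\<in>{1..card P}. i \<noteq> j \<longrightarrow>
              dist_inf (q i) (l j) \<ge> 1 / (2 * real N))"
proof -
  have "finite P"
    using assms(5) finite_lattice_box by (rule finite_subset)
  then obtain f where f: "bij_betw f {1..card P} P"
    by (rule exE[OF ex_bij_betw_nat_finite_1])
  have fP: "f i \<in> P" if "i \<in> {1..card P}" for i
    using bij_betwE[OF f] that by simp
  have f_inj: "inj_on f {1..card P}"
    using f by (rule bij_betw_imp_inj_on)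
  define q where "q i = rescale N M (real_point (f i))" for i
  define l where "l i = line_dir (q i) (rescale N M (real_point (s (f i))))" for i
  have "q i \<in> cbox 0 One \<and> is_line (l i) \<and> q i \<in> l i" if "i \<in> {1..card P}" for i
  proof (intro conjI)
    show "q i \<in> cbox 0 One"
      unfolding q_def using fP[OF that] assms(5) by (intro rescale_mem_unit_cube) auto
    \<comment> \<open>The last coordinate of this direction is \<open>1 / M\<close>.\<close>
    have "rescale N M (real_point (s (f i))) \<noteq> 0"
      using assms(2) assms(6)[OF fP[OF that]]
      by (simp add: rescale_def real_point_def zero_prod_def)
    then show "is_line (l i)"
      unfolding is_line_def l_def by blast
    show "q i \<in> l i"
      unfolding l_def line_dir_def by (auto intro!: exI[where x = 0])
  qed
  moreover have "1 / (2 * real N) \<le> dist_inf (q i) (l j)"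
    if ij: "i \<in> {1..card P}" "j \<in> {1..card P}" "i \<noteq> j" for i j
    unfolding dist_inf_def
  \<comment> \<open>A bound valid at every point of the line passes to the infimum, provided the
    line is nonempty.\<close>
  proof (rule cINF_greatest)
    show "l j \<noteq> {}"
      unfolding l_def line_dir_def by blast
    fix r assume "r \<in> l j"
    then obtain t where r: "r = q j + t *\<^sub>R rescale N M (real_point (s (f j)))"
      unfolding l_def line_dir_def by blast
    have "f j \<noteq> f i"
      using inj_on_eq_iff[OF f_inj ij(2) ij(1)] ij(3) by simp
    \<comment> \<open>The line starts at \<open>f j\<close>, so \<open>f j\<close> plays the role of
      \<open>(x, y)\<close> and \<open>f i\<close> that of \<open>(x', y')\<close>.\<close>
    then show "1 / (2 * real N) \<le> infnorm (q i - r)"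
      using infnorm_rescale_ge[OF assms(1,2,4) assms(7)[OF fP[OF ij(2)]],
          of "fst (f i)" "snd (f i)" "fst (f j)" "snd (f j)" t]
        assms(8)[OF fP[OF ij(2)] fP[OF ij(1)]] assms(6)[OF fP[OF ij(2)]]
      by (simp add: r q_def)
  qed
  ultimately show ?thesis
    by blast
qed

end
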